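(* Let $m \ge 2$ be an even integer, let $n \ge 1$, and let $\mathcal{A} = (a_{i_1\cdots i_m})$ be a real $m$th order $n$-dimensional tensor that is a P-tensor. Then $$\alpha(F_{\mathcal{A}}) \le \left(\delta_H(\mathcal{A})\right)^{\frac{1}{m-1}} \le \left(\min_{i\in I_n} a_{ii\cdots i}\right)^{\frac{1}{m-1}}.$$
   Context: Let $I_n = \{1,\dots,n\}$. A real $m$th order $n$-dimensional tensor $\mathcal{A} = (a_{i_1\cdots i_m})$ is a multi-array of real entries $a_{i_1\cdots i_m}$, with $i_j \in I_n$ for $j = 1,\dots,m$ (no symmetry is assumed). For a vector $x \in \mathbb{R}^n$, $\mathcal{A}x^{m-1} \in \mathbb{R}^n$ is the vector with $i$th component $$(\mathcal{A}x^{m-1})_i = \sum_{i_2,\dots,i_m=1}^n a_{i i_2\cdots i_m} x_{i_2}\cdots x_{i_m}, \quad i \in I_n.$$ P-tensor: $\mathcal{A}$ is a P-tensor iff for every nonzero $x \in \mathbb{R}^n$, $\max_{i \in I_n} x_i (\mathcal{A}x^{m-1})_i > 0$. For a vector $x$ and exponent $p$, $x^{[p]}$ denotes the vector with $i$th component $x_i^{p}$; for $m$ even, $m-1$ is odd and $t^{1/(m-1)}$ denotes the real $(m-1)$th root of $t \in \mathbb{R}$. H-eigenvalue: a real number $\lambda$ is an H-eigenvalue of $\mathcal{A}$ iff there is a nonzero $x \in \mathbb{R}^n$ with $\mathcal{A}x^{m-1} = \lambda x^{[m-1]}$. Principal sub-tensor: for a nonempty $J \subset I_n$ with $|J| = r$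 ($1 \le r \le n$), $\mathcal{A}_r^J$ is the $m$th order $r$-dimensional tensor $(a_{i_1\cdots i_m})$ with $i_1,\dots,i_m \in J$. The quantity $\delta_H$: for $m$ even and $\mathcal{A}$ a P-tensor, let $\lambda_H(\mathcal{A}_r^J)$ denote the smallest H-eigenvalue of $\mathcal{A}_r^J$ (if any exists), and $$\delta_H(\mathcal{A}) := \min\{\lambda_H(\mathcal{A}_r^J) : J \subset I_n,\ |J| = r,\ r \in I_n\},$$ where the minimum ranges over those principal sub-tensors of $\mathcal{A}$ that have H-eigenvalues. (For $m$ even and $\mathcal{A}$ a P-tensor this is well defined, finite and positive.) The quantity $\alpha(F_{\mathcal{A}})$: for $m$ even, $F_{\mathcal{A}} : \mathbb{R}^n \to \mathbb{R}^n$ is defined by $F_{\mathcal{A}}(x) := (\mathcal{A}x^{m-1})^{[\frac{1}{m-1}]}$, and $$\alpha(F_{\mathcal{A}}) := \min_{\|x\|_\infty = 1}\ \max_{i \in I_n} x_i (F_{\mathcal{A}}(x))_i,$$ where $x$ ranges over $\mathbb{R}^n$ and $\|x\|_\infty = \max_{i \in I_n}|x_i|$. *)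

theory Defs
  imports Complex_Main "HOL-Library.FuncSet"
begin

text \<open>
  Tensors and vectors are total functions that are only ever inspected on a finite index
  set: over the index set \<open>J\<close>, an order \<open>m\<close> tensor has the entry \<open>A [i\<^sub>1, \<dots>, i\<^sub>m]\<close> for
  \<open>i\<^sub>1, \<dots>, i\<^sub>m \<in> J\<close>, and a vector of \<open>\<real>\<^sup>J\<close> has the coordinates \<open>x j\<close> for \<open>j \<in> J\<close>; all other
  values are irrelevant.  Carrying \<open>J\<close> explicitly lets a tensor over \<open>{1..n}\<close> and its
  principal sub-tensors over subsets \<open>J\<close> be treated by the same definitions.
\<close>

type_synonym tensor = "nat list \<Rightarrow> real"

definition multi_indices :: "nat \<Rightarrow> nat set \<Rightarrow> nat list set" where
  "multi_indices k J = {ks. set ks \<subseteq> J \<and> length ks = k}"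

text \<open>The vector \<open>A x\<^sup>m\<^sup>-\<^sup>1\<close>; its coordinates are those with \<open>i \<in> J\<close>.\<close>

definition tensor_apply :: "nat \<Rightarrow> nat set \<Rightarrow> tensor \<Rightarrow> (nat \<Rightarrow> real) \<Rightarrow> nat \<Rightarrow> real" where
  "tensor_apply m J A x i =
     (\<Sum>ks\<in>multi_indices (m - 1) J. A (i # ks) * prod_list (map x ks))"

definition nonzero_on :: "nat set \<Rightarrow> (nat \<Rightarrow> real) \<Rightarrow> bool" where
  "nonzero_on J x \<longleftrightarrow> (\<exists>i\<in>J. x i \<noteq> 0)"

definition P_tensor :: "nat \<Rightarrow> nat set \<Rightarrow> tensor \<Rightarrow> bool" where
  "P_tensor m J A \<longleftrightarrow>
     (\<forall>x. nonzero_on J x \<longrightarrow> Max ((\<lambda>i. x i * tensor_apply m J A x i) ` J) > 0)"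

definition H_eigenvalue :: "nat \<Rightarrow> nat set \<Rightarrow> tensor \<Rightarrow> real \<Rightarrow> bool" where
  "H_eigenvalue m J A l \<longleftrightarrow>
     (\<exists>x. nonzero_on J x \<and> (\<forall>i\<in>J. tensor_apply m J A x i = l * x i ^ (m - 1)))"

definition principal_subtensor :: "nat \<Rightarrow> tensor \<Rightarrow> nat set \<Rightarrow> tensor" where
  "principal_subtensor m A J = restrict A (multi_indices m J)"

text \<open>\<open>Least\<close> denotes an actual minimum; it is unspecified where none is attained.\<close>

definition smallest_H_eigenvalue :: "nat \<Rightarrow> nat set \<Rightarrow> tensor \<Rightarrow> real" where
  "smallest_H_eigenvalue m J A = (LEAST l. H_eigenvalue m J A l)"

definition delta_H :: "nat \<Rightarrow> nat set \<Rightarrow> tensor \<Rightarrow> real" where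
  "delta_H m I A =
     Min {smallest_H_eigenvalue m J (principal_subtensor m A J) | J.
            J \<subseteq> I \<and> J \<noteq> {} \<and> (\<exists>l. H_eigenvalue m J (principal_subtensor m A J) l)}"

definition sup_norm_on :: "nat set \<Rightarrow> (nat \<Rightarrow> real) \<Rightarrow> real" where
  "sup_norm_on I x = Max ((\<lambda>i. \<bar>x i\<bar>) ` I)"

text \<open>For odd \<open>k\<close>, \<open>root k\<close> is the real \<open>k\<close>-th root on all of \<open>\<real>\<close>, negative arguments included.\<close>

definition F_op :: "nat \<Rightarrow> nat set \<Rightarrow> tensor \<Rightarrow> (nat \<Rightarrow> real) \<Rightarrow> nat \<Rightarrow> real" where
  "F_op m I A x i = root (m - 1) (tensor_apply m I A x i)"

definition alpha :: "nat set \<Rightarrow> ((nat \<Rightarrow> real) \<Rightarrow> nat \<Rightarrow> real) \<Rightarrow> real" where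
  "alpha I F =
     (LEAST v. \<exists>x. sup_norm_on I x = 1 \<and> v = Max ((\<lambda>i. x i * F x i) ` I))"

end

theory Submission
  imports Defs "HOL-Analysis.Function_Topology"
begin

text \<open>
  Both inequalities come from testing a minimum at one well-chosen competitor.

  For the first one, let \<open>\<delta>\<close> be the least H-eigenvalue of a principal sub-tensor over \<open>J\<close> that
  realises the minimum.  An eigenvector for \<open>\<delta>\<close>, extended by zero outside \<open>J\<close> and scaled to sup
  norm \<open>1\<close>, gives a vector \<open>x\<close> with \<open>x\<^sub>i F(x)\<^sub>i = \<delta>\<^bsup>1/(m-1)\<^esup> x\<^sub>i\<^sup>2\<close> on \<open>J\<close> and \<open>0\<close> elsewhere.
  The P-property applied to \<open>x\<close> forces \<open>\<delta> > 0\<close>, so the maximum of these numbers is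
  \<open>\<delta>\<^bsup>1/(m-1)\<^esup>\<close>, and the minimum \<open>\<alpha>\<close> is at most this value
  (\<open>alpha_le_root_eigenvalue_of_subtensor\<close>).  For the second one, the sub-tensor over
  \<open>{i}\<close> has the diagonal entry \<open>a\<^bsub>i\<dots>i\<^esub>\<close> as its only H-eigenvalue.

  What remains is that the two minima over infinite sets are attained: the one defining
  \<open>\<alpha>\<close>, and the least H-eigenvalue.  Both follow from compactness of the unit
  sphere of the sup norm.  For eigenvalues the point is that an eigenvalue is a continuous function
  of its eigenvector, namely \<open>(\<Sum>j. x\<^sub>j (A x\<^bsup>m-1\<^esup>)\<^sub>j) / (\<Sum>j. x\<^sub>j\<^sup>m)\<close>, whose
  denominator is positive for even \<open>m\<close>
  (\<open>H_eigenvalue_iff_eigen_quotient\<close>); substituting this quotient for the eigenvalue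
  also shows that the normalised eigenvectors form a closed subset of the sphere.
\<close>

section \<open>The action of a tensor on vectors\<close>

lemma finite_multi_indices: "finite J \<Longrightarrow> finite (multi_indices k J)"
  unfolding multi_indices_def by (rule finite_lists_length_eq)

lemma tensor_apply_cong:
  assumes "\<And>i. i \<in> J \<Longrightarrow> x i = y i"
  shows "tensor_apply m J A x = tensor_apply m J A y"
  unfolding tensor_apply_def
proof (intro ext sum.cong refl)
  fix i ks assume "ks \<in> multi_indices (m - 1) J"
  then have "map x ks = map y ks"
    using assms by (auto simp: multi_indices_def)
  then show "A (i # ks) * prod_list (map x ks) = A (i # ks) * prod_list (map y ks)"
    by (simp only:)
qed

lemma tensor_apply_scale:
  "tensor_apply m J A (\<lambda>i. c * x i) i = c ^ (m - 1) * tensor_apply m J A x i"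
proof -
  have "prod_list (map (\<lambda>i. c * x i) ks) = c ^ length ks * prod_list (map x ks)" for ks
    by (induction ks) auto
  then show ?thesis
    unfolding tensor_apply_def sum_distrib_left
    by (intro sum.cong) (auto simp: multi_indices_def)
qed

text \<open>On a vector supported in \<open>J\<close>, every monomial with an index outside \<open>J\<close> vanishes.\<close>

lemma tensor_apply_supported:
  assumes "finite I" "J \<subseteq> I" "m \<ge> 1" "i \<in> J" "\<And>k. k \<notin> J \<Longrightarrow> x k = 0"
  shows "tensor_apply m I A x i = tensor_apply m J (principal_subtensor m A J) x i"
proof -
  have "tensor_apply m I A x i
      = (\<Sum>ks\<in>multi_indices (m - 1) J. A (i # ks) * prod_list (map x ks))"
    unfolding tensor_apply_def
  proof (rule sum.mono_neutral_right)
    show "finite (multi_indices (m - 1) I)"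
      using assms by (simp add: finite_multi_indices)
    show "multi_indices (m - 1) J \<subseteq> multi_indices (m - 1) I"
      using assms by (auto simp: multi_indices_def)
    show "\<forall>ks\<in>multi_indices (m - 1) I - multi_indices (m - 1) J.
        A (i # ks) * prod_list (map x ks) = 0"
    proof
      fix ks assume "ks \<in> multi_indices (m - 1) I - multi_indices (m - 1) J"
      then obtain k where "k \<in> set ks" "k \<notin> J"
        by (auto simp: multi_indices_def)
      then have "0 \<in> set (map x ks)"
        using assms(5) by force
      then show "A (i # ks) * prod_list (map x ks) = 0"
        by (simp add: prod_list_zero_iff)
    qed
  qed
  also have "\<dots> = tensor_apply m J (principal_subtensor m A J) x i"
    unfolding tensor_apply_def
    using assms by (intro sum.cong) (auto simp: principal_subtensor_def multi_indices_def)
  finally show ?thesis .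
qed

lemma tensor_apply_singleton:
  "tensor_apply m {i} A x i = A (i # replicate (m - 1) i) * x i ^ (m - 1)"
proof -
  have "multi_indices (m - 1) {i} = {replicate (m - 1) i}"
    by (auto simp: multi_indices_def intro: replicate_eqI)
  then show ?thesis
    by (simp add: tensor_apply_def)
qed

lemma continuous_on_tensor_apply:
  "continuous_on S (\<lambda>x. tensor_apply m J A x i)"
proof -
  have "continuous_on S (\<lambda>x :: nat \<Rightarrow> real. prod_list (map x ks))" for ks
    by (induction ks) (auto intro!: continuous_intros continuous_on_product_coordinates
        continuous_on_subset[OF continuous_on_product_coordinates])
  then show ?thesis
    unfolding tensor_apply_def by (intro continuous_intros)
qed

section \<open>Attained minima on the unit sphere of the sup norm\<close>

lemma continuous_on_Max:
  fixes f :: "'i \<Rightarrow> 'a::topological_space \<Rightarrow> 'b::linorder_topology"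
  assumes "finite I" "I \<noteq> {}" "\<And>i. i \<in> I \<Longrightarrow> continuous_on S (f i)"
  shows "continuous_on S (\<lambda>x. Max ((\<lambda>i. f i x) ` I))"
  using assms by (induction I rule: finite_ne_induct) (auto intro!: continuous_on_max)

text \<open>The extreme value theorem, in the form that gives \<open>LEAST\<close> a meaning in a type such as \<open>\<real>\<close>, where
  it need not denote anything useful.\<close>

lemma continuous_attains_Least:
  fixes f :: "'a::topological_space \<Rightarrow> 'b::linorder_topology"
  assumes "compact S" "S \<noteq> {}" "continuous_on S f"
  shows "\<exists>x\<in>S. (LEAST v. \<exists>y\<in>S. v = f y) = f x"
    and "y \<in> S \<Longrightarrow> (LEAST v. \<exists>y\<in>S. v = f y) \<le> f y"
proof -
  obtain x where x: "x \<in> S" "\<And>y. y \<in> S \<Longrightarrow> f x \<le> f y"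
    using continuous_attains_inf[OF assms] by blast
  then have least: "(LEAST v. \<exists>y\<in>S. v = f y) = f x"
    by (intro Least_equality) auto
  then show "\<exists>x\<in>S. (LEAST v. \<exists>y\<in>S. v = f y) = f x"
    using x by blast
  show "(LEAST v. \<exists>y\<in>S. v = f y) \<le> f y" if "y \<in> S"
    using least x that by simp
qed

text \<open>Coordinates outside \<open>J\<close> are pinned to \<open>0\<close>: without this the set would not be compact in the
  product topology on all sequences.\<close>

definition sup_sphere :: "nat set \<Rightarrow> (nat \<Rightarrow> real) set" where
  "sup_sphere J = {x. sup_norm_on J x = 1 \<and> (\<forall>i. i \<notin> J \<longrightarrow> x i = 0)}"

lemma abs_le_sup_norm_on: "finite J \<Longrightarrow> i \<in> J \<Longrightarrow> \<bar>x i\<bar> \<le> sup_norm_on J x"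
  unfolding sup_norm_on_def by (intro Max_ge) auto

lemma sup_norm_on_attained:
  assumes "finite J" "J \<noteq> {}"
  obtains i where "i \<in> J" "sup_norm_on J x = \<bar>x i\<bar>"
proof -
  have "Max ((\<lambda>i. \<bar>x i\<bar>) ` J) \<in> (\<lambda>i. \<bar>x i\<bar>) ` J"
    using assms by (intro Max_in) auto
  then show thesis
    using that unfolding sup_norm_on_def by blast
qed

lemma sup_norm_on_cong: "(\<And>i. i \<in> J \<Longrightarrow> x i = y i) \<Longrightarrow> sup_norm_on J x = sup_norm_on J y"
  by (simp add: sup_norm_on_def cong: image_cong)

lemma nonzero_on_sup_sphere:
  assumes "finite J" "J \<noteq> {}" "x \<in> sup_sphere J"
  shows "nonzero_on J x"
proof -
  obtain i where "i \<in> J" "sup_norm_on J x = \<bar>x i\<bar>"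
    by (rule sup_norm_on_attained[OF assms(1,2)])
  then show ?thesis
    using assms(3) by (force simp: nonzero_on_def sup_sphere_def)
qed

lemma compact_sup_sphere:
  assumes "finite J" "J \<noteq> {}"
  shows "compact (sup_sphere J)"
proof -
  define K :: "nat \<Rightarrow> real set" where "K i = (if i \<in> J then {-1..1} else {0})" for i
  \<comment> \<open>The sphere is cut out of a product of compact sets by one closed condition; the product is
    compact by Tychonoff's theorem.\<close>
  have "compactin (product_topology (\<lambda>i::nat. euclidean) UNIV) (PiE UNIV K)"
    by (auto simp: compactin_PiE K_def)
  then have "compact (PiE UNIV K)"
    by (simp add: euclidean_product_topology)
  moreover have "closed {x. sup_norm_on J x = 1}"
    unfolding sup_norm_on_def using assms
    by (intro closed_Collect_eq continuous_on_Max continuous_intros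
        continuous_on_product_coordinates) auto
  moreover have "sup_sphere J = PiE UNIV K \<inter> {x. sup_norm_on J x = 1}"
  proof (intro set_eqI iffI)
    fix x assume x: "x \<in> sup_sphere J"
    have "\<bar>x i\<bar> \<le> 1" if "i \<in> J" for i
      using abs_le_sup_norm_on[OF assms(1) that, of x] x by (simp add: sup_sphere_def)
    then show "x \<in> PiE UNIV K \<inter> {x. sup_norm_on J x = 1}"
      using x by (fastforce simp: K_def sup_sphere_def abs_le_iff)
  next
    fix x assume "x \<in> PiE UNIV K \<inter> {x. sup_norm_on J x = 1}"
    then show "x \<in> sup_sphere J"
      by (auto simp: K_def sup_sphere_def PiE_iff split: if_splits)
  qed
  ultimately show ?thesis
    by (simp add: compact_Int_closed)
qed

text \<open>Dividing by the sup norm works; the truncation is harmless since coordinates outside \<open>J\<close> carry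
  no information about a vector of \<open>\<real>\<^sup>J\<close>.\<close>

lemma normalise_nonzero_on:
  assumes "finite J" "nonzero_on J x"
  obtains c where "(\<lambda>i. if i \<in> J then c * x i else 0) \<in> sup_sphere J"
proof -
  define s where "s = sup_norm_on J x"
  obtain k where k: "k \<in> J" "x k \<noteq> 0"
    using assms by (auto simp: nonzero_on_def)
  then have "s > 0"
    using abs_le_sup_norm_on[OF assms(1) k(1), of x] by (simp add: s_def)
  obtain j where j: "j \<in> J" "s = \<bar>x j\<bar>"
    unfolding s_def using sup_norm_on_attained[OF assms(1)] k by blast
  have "sup_norm_on J (\<lambda>i. if i \<in> J then 1 / s * x i else 0) = 1"
    unfolding sup_norm_on_def
  proof (rule Max_eqI)
    fix y assume "y \<in> (\<lambda>i. \<bar>if i \<in> J then 1 / s * x i else 0\<bar>) ` J"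
    then show "y \<le> 1"
      using abs_le_sup_norm_on[OF assms(1), of _ x] \<open>s > 0\<close>
      by (auto simp: abs_mult s_def[symmetric])
  next
    show "1 \<in> (\<lambda>i. \<bar>if i \<in> J then 1 / s * x i else 0\<bar>) ` J"
      using j \<open>s > 0\<close> by (intro image_eqI[of _ _ j]) (auto simp: abs_mult)
  qed (use assms in simp)
  then show thesis
    by (intro that[of "1 / s"]) (auto simp: sup_sphere_def)
qed

text \<open>The values over the whole sup norm unit sphere are already taken on \<open>sup_sphere I\<close>, since
  \<open>F\<close> sees the coordinates in \<open>I\<close> alone; there compactness applies.\<close>

lemma alpha_F_op_le:
  assumes "finite I" "I \<noteq> {}" "x \<in> sup_sphere I"
  shows "alpha I (F_op m I A) \<le> Max ((\<lambda>i. x i * F_op m I A x i) ` I)"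
proof -
  define g where "g x = Max ((\<lambda>i. x i * F_op m I A x i) ` I)" for x
  have "(\<exists>x. sup_norm_on I x = 1 \<and> v = g x) \<longleftrightarrow> (\<exists>x\<in>sup_sphere I. v = g x)" for v
  proof
    assume "\<exists>x. sup_norm_on I x = 1 \<and> v = g x"
    then obtain x where x: "sup_norm_on I x = 1" "v = g x"
      by blast
    define y where "y i = (if i \<in> I then x i else 0)" for i
    have "sup_norm_on I y = sup_norm_on I x"
      by (rule sup_norm_on_cong) (simp add: y_def)
    moreover have "tensor_apply m I A y = tensor_apply m I A x"
      by (rule tensor_apply_cong) (simp add: y_def)
    then have "g y = g x"
      unfolding g_def F_op_def by (intro arg_cong[where f = Max] image_cong) (auto simp: y_def)
    ultimately show "\<exists>x\<in>sup_sphere I. v = g x"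
      using x by (intro bexI[of _ y]) (auto simp: sup_sphere_def y_def)
  qed (auto simp: sup_sphere_def)
  then have "alpha I (F_op m I A) = (LEAST v. \<exists>x\<in>sup_sphere I. v = g x)"
    by (simp add: alpha_def g_def)
  also have "\<dots> \<le> g x"
  proof (rule continuous_attains_Least(2))
    show "continuous_on (sup_sphere I) g"
      unfolding g_def F_op_def using assms
      by (intro continuous_on_Max continuous_intros continuous_on_tensor_apply
          continuous_on_subset[OF continuous_on_product_coordinates]) auto
  qed (use assms compact_sup_sphere in auto)
  finally show ?thesis
    by (simp add: g_def)
qed

section \<open>Existence of a smallest H-eigenvalue\<close>

definition eigen_quotient :: "nat \<Rightarrow> nat set \<Rightarrow> tensor \<Rightarrow> (nat \<Rightarrow> real) \<Rightarrow> real" where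
  "eigen_quotient m J A x = (\<Sum>j\<in>J. x j * tensor_apply m J A x j) / (\<Sum>j\<in>J. x j ^ m)"

lemma sum_even_power_pos:
  fixes x :: "nat \<Rightarrow> real"
  assumes "finite J" "even m" "nonzero_on J x"
  shows "(\<Sum>j\<in>J. x j ^ m) > 0"
proof -
  obtain k where "k \<in> J" "x k \<noteq> 0"
    using assms by (auto simp: nonzero_on_def)
  then show ?thesis
    using assms by (intro sum_pos2[of J k]) (auto simp: zero_less_power_eq zero_le_even_power)
qed

text \<open>Pairing the eigenvalue equation with the eigenvector recovers the eigenvalue.\<close>

lemma eigenvalue_eq_eigen_quotient:
  assumes "finite J" "even m" "m > 0" "nonzero_on J x"
    and "\<forall>i\<in>J. tensor_apply m J A x i = l * x i ^ (m - 1)"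
  shows "l = eigen_quotient m J A x"
proof -
  have "x j * x j ^ (m - 1) = x j ^ m" for j
    using \<open>m > 0\<close> by (simp add: power_eq_if)
  then have "(\<Sum>j\<in>J. x j * tensor_apply m J A x j) = l * (\<Sum>j\<in>J. x j ^ m)"
    using assms(5) by (simp add: sum_distrib_left mult.left_commute)
  then show ?thesis
    using sum_even_power_pos[OF assms(1,2,4)] by (simp add: eigen_quotient_def)
qed

text \<open>The eigenvalue equation is homogeneous of degree \<open>m - 1\<close>, so eigenvectors may be normalised; and
  replacing the eigenvalue by the quotient leaves a condition on the vector alone.\<close>

lemma H_eigenvalue_iff_eigen_quotient:
  assumes "finite J" "J \<noteq> {}" "even m" "m > 0"
  shows "H_eigenvalue m J A l \<longleftrightarrow>
    (\<exists>x\<in>{x \<in> sup_sphere J. \<forall>i\<in>J. tensor_apply m J A x i = eigen_quotient m J A x * x i ^ (m - 1)}.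
       l = eigen_quotient m J A x)"
proof
  assume "H_eigenvalue m J A l"
  then obtain x where x: "nonzero_on J x" "\<forall>i\<in>J. tensor_apply m J A x i = l * x i ^ (m - 1)"
    by (auto simp: H_eigenvalue_def)
  then obtain c where c: "(\<lambda>i. if i \<in> J then c * x i else 0) \<in> sup_sphere J"
    using normalise_nonzero_on[OF assms(1)] by blast
  define y where "y i = (if i \<in> J then c * x i else 0)" for i
  have y: "y \<in> sup_sphere J"
    using c by (simp add: y_def[abs_def])
  have "tensor_apply m J A y = tensor_apply m J A (\<lambda>i. c * x i)"
    by (rule tensor_apply_cong) (simp add: y_def)
  then have eq: "\<forall>i\<in>J. tensor_apply m J A y i = l * y i ^ (m - 1)"
    using x by (simp add: tensor_apply_scale y_def power_mult_distrib)
  have "l = eigen_quotient m J A y"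
    using eigenvalue_eq_eigen_quotient[OF assms(1,3,4) _ eq] nonzero_on_sup_sphere[OF assms(1,2) y]
    by blast
  then show "\<exists>x\<in>{x \<in> sup_sphere J. \<forall>i\<in>J. tensor_apply m J A x i
      = eigen_quotient m J A x * x i ^ (m - 1)}. l = eigen_quotient m J A x"
    using y eq by blast
next
  assume "\<exists>x\<in>{x \<in> sup_sphere J. \<forall>i\<in>J. tensor_apply m J A x i
      = eigen_quotient m J A x * x i ^ (m - 1)}. l = eigen_quotient m J A x"
  then show "H_eigenvalue m J A l"
    using nonzero_on_sup_sphere[OF assms(1,2)] by (auto simp: H_eigenvalue_def)
qed

text \<open>The set of H-eigenvalues is the image of the compact set of normalised eigenvectors under the
  continuous quotient, so it has a minimum as soon as it is nonempty.\<close>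

lemma H_eigenvalue_smallest:
  assumes "finite J" "even m" "m > 0" "H_eigenvalue m J A l"
  shows "H_eigenvalue m J A (smallest_H_eigenvalue m J A)"
proof -
  let ?q = "eigen_quotient m J A"
  define E where
    "E = {x \<in> sup_sphere J. \<forall>i\<in>J. tensor_apply m J A x i = ?q x * x i ^ (m - 1)}"
  have "J \<noteq> {}"
    using assms(4) by (auto simp: H_eigenvalue_def nonzero_on_def)
  have eig: "H_eigenvalue m J A v \<longleftrightarrow> (\<exists>x\<in>E. v = ?q x)" for v
    unfolding E_def by (rule H_eigenvalue_iff_eigen_quotient) (use assms \<open>J \<noteq> {}\<close> in auto)
  have cont: "continuous_on (sup_sphere J) ?q"
    unfolding eigen_quotient_def
  proof (intro continuous_intros continuous_on_tensor_apply
      continuous_on_subset[OF continuous_on_product_coordinates] ballI)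
    fix x assume "x \<in> sup_sphere J"
    then show "(\<Sum>j\<in>J. x j ^ m) \<noteq> 0"
      using sum_even_power_pos[OF assms(1,2)] nonzero_on_sup_sphere[OF assms(1) \<open>J \<noteq> {}\<close>]
      by (metis less_irrefl)
  qed auto
  have sphere: "compact (sup_sphere J)"
    using assms \<open>J \<noteq> {}\<close> by (simp add: compact_sup_sphere)
  \<comment> \<open>Closedness is relative to the sphere, because the quotient is continuous only away from
    zero denominators.\<close>
  have "compact E"
  proof -
    have "closedin (top_of_set (sup_sphere J))
        {x \<in> sup_sphere J. tensor_apply m J A x i - ?q x * x i ^ (m - 1) = 0}" for i
      by (intro continuous_closedin_preimage_constant continuous_intros cont
          continuous_on_tensor_apply continuous_on_subset[OF continuous_on_product_coordinates])
        auto
    then have "closedin (top_of_set (sup_sphere J))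
        (\<Inter>i\<in>J. {x \<in> sup_sphere J. tensor_apply m J A x i - ?q x * x i ^ (m - 1) = 0})"
      using \<open>J \<noteq> {}\<close> by (intro closedin_Inter) auto
    also have "(\<Inter>i\<in>J. {x \<in> sup_sphere J. tensor_apply m J A x i - ?q x * x i ^ (m - 1) = 0}) = E"
      using \<open>J \<noteq> {}\<close> by (auto simp: E_def)
    finally show ?thesis
      using sphere closedin_compact by blast
  qed
  moreover have "E \<noteq> {}"
    using eig assms(4) by blast
  moreover have "continuous_on E ?q"
    using cont by (rule continuous_on_subset) (auto simp: E_def)
  ultimately have "\<exists>x\<in>E. (LEAST v. \<exists>y\<in>E. v = ?q y) = ?q x"
    by (rule continuous_attains_Least(1))
  then show ?thesis
    by (simp add: smallest_H_eigenvalue_def eig)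
qed

section \<open>Comparing the three quantities\<close>

text \<open>Since \<open>m - 1\<close> is odd, the real root undoes the power in the eigenvalue equation with the
  correct sign, and \<open>F\<close> acts on an eigenvector supported in \<open>J\<close> as multiplication by
  \<open>\<lambda>\<^bsup>1/(m-1)\<^esup>\<close> there.\<close>

lemma alpha_le_root_eigenvalue_of_subtensor:
  assumes "even m" "m \<ge> 2" "finite I" "P_tensor m I A" "J \<subseteq> I"
    and "H_eigenvalue m J (principal_subtensor m A J) l"
  shows "alpha I (F_op m I A) \<le> root (m - 1) l"
proof -
  let ?B = "principal_subtensor m A J"
  have "finite J"
    using assms by (auto intro: finite_subset)
  have "J \<noteq> {}"
    using assms(6) by (auto simp: H_eigenvalue_def nonzero_on_def)
  with assms have "I \<noteq> {}"
    by auto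
  have "m > 0" "odd (m - 1)"
    using assms by auto
  obtain x where x: "x \<in> sup_sphere J" and eq: "\<forall>i\<in>J. tensor_apply m J ?B x i = l * x i ^ (m - 1)"
    using assms(6)
    unfolding H_eigenvalue_iff_eigen_quotient[OF \<open>finite J\<close> \<open>J \<noteq> {}\<close> \<open>even m\<close> \<open>m > 0\<close>]
    by auto
  have x0: "x i = 0" if "i \<notin> J" for i
    using x that by (simp add: sup_sphere_def)
  have app: "tensor_apply m I A x i = l * x i ^ (m - 1)" if "i \<in> J" for i
    using tensor_apply_supported[OF \<open>finite I\<close> \<open>J \<subseteq> I\<close> _ that x0] assms eq that by simp
  have x_le: "\<bar>x i\<bar> \<le> 1" for i
    using abs_le_sup_norm_on[OF \<open>finite J\<close>, of i x] x x0[of i]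
    by (cases "i \<in> J") (auto simp: sup_sphere_def)
  obtain k where k: "k \<in> J" "\<bar>x k\<bar> = 1"
    using sup_norm_on_attained[OF \<open>finite J\<close> \<open>J \<noteq> {}\<close>, of x] x by (auto simp: sup_sphere_def)
  have xI: "x \<in> sup_sphere I"
  proof -
    have "sup_norm_on I x = 1"
      unfolding sup_norm_on_def
      using k x_le \<open>J \<subseteq> I\<close> \<open>finite I\<close> by (intro Max_eqI) (auto intro!: image_eqI[of _ _ k])
    then show ?thesis
      using x0 \<open>J \<subseteq> I\<close> by (auto simp: sup_sphere_def)
  qed
  \<comment> \<open>Positivity is needed twice below: to bound \<open>l\<^bsup>1/(m-1)\<^esup> x\<^sub>i\<^sup>2\<close> by \<open>l\<^bsup>1/(m-1)\<^esup>\<close>, and to make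
    the zero entries outside \<open>J\<close> no larger than that.\<close>
  have "l > 0"
  proof -
    have "Max ((\<lambda>i. x i * tensor_apply m I A x i) ` I) > 0"
      using assms(4) nonzero_on_sup_sphere[OF \<open>finite I\<close> \<open>I \<noteq> {}\<close> xI] by (simp add: P_tensor_def)
    then obtain i where i: "i \<in> I" "x i * tensor_apply m I A x i > 0"
      using \<open>finite I\<close> \<open>I \<noteq> {}\<close> by (auto simp: Max_gr_iff)
    then have "i \<in> J"
      using x0 by fastforce
    then have "x i * tensor_apply m I A x i = l * x i ^ m"
      using app \<open>m > 0\<close> by (simp add: power_eq_if)
    moreover have "x i ^ m \<ge> 0"
      using \<open>even m\<close> by (rule zero_le_even_power)
    ultimately show ?thesis
      using i(2) by (metis zero_less_mult_pos2 less_le mult_zero_right)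
  qed
  have "x i * F_op m I A x i \<le> root (m - 1) l" if "i \<in> I" for i
  proof (cases "i \<in> J")
    case True
    then have "F_op m I A x i = root (m - 1) l * x i"
      using \<open>odd (m - 1)\<close> by (simp add: F_op_def app real_root_mult odd_real_root_power_cancel)
    then have "x i * F_op m I A x i = root (m - 1) l * (x i)\<^sup>2"
      by (simp add: power2_eq_square)
    also have "\<dots> \<le> root (m - 1) l * 1"
      using \<open>l > 0\<close> x_le[of i]
      by (intro mult_left_mono) (auto simp: abs_square_le_1 real_root_ge_zero)
    finally show ?thesis
      by simp
  next
    case False
    then show ?thesis
      using x0 \<open>l > 0\<close> by (simp add: real_root_ge_zero)
  qed
  then have "Max ((\<lambda>i. x i * F_op m I A x i) ` I) \<le> root (m - 1) l"
    using \<open>finite I\<close> \<open>I \<noteq> {}\<close> by simp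
  with alpha_F_op_le[OF \<open>finite I\<close> \<open>I \<noteq> {}\<close> xI] show ?thesis
    by (rule order_trans)
qed

lemma H_eigenvalue_singleton:
  assumes "m \<ge> 1"
  shows "H_eigenvalue m {i} (principal_subtensor m A {i}) l \<longleftrightarrow> l = A (replicate m i)"
proof -
  have rep: "i # replicate (m - 1) i = replicate m i"
    using assms by (cases m) auto
  have "principal_subtensor m A {i} (replicate m i) = A (replicate m i)"
    by (auto simp: principal_subtensor_def multi_indices_def)
  then have app: "tensor_apply m {i} (principal_subtensor m A {i}) x i
      = A (replicate m i) * x i ^ (m - 1)" for x
    using rep by (simp add: tensor_apply_singleton)
  show ?thesis
  proof
    assume "l = A (replicate m i)"
    then show "H_eigenvalue m {i} (principal_subtensor m A {i}) l"
      by (auto simp: H_eigenvalue_def nonzero_on_def app intro!: exI[of _ "\<lambda>_. 1"])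
  qed (auto simp: H_eigenvalue_def nonzero_on_def app)
qed

theorem theorem3p1:
  fixes m n :: nat and A :: tensor
  assumes "m \<ge> 2" and "even m" and "n \<ge> 1"
    and "P_tensor m {1..n} A"
  shows "alpha {1..n} (F_op m {1..n} A) \<le> root (m - 1) (delta_H m {1..n} A)
       \<and> root (m - 1) (delta_H m {1..n} A)
           \<le> root (m - 1) (Min ((\<lambda>i. A (replicate m i)) ` {1..n}))"
proof -
  let ?I = "{1..n}"
  let ?ev = "\<lambda>J. H_eigenvalue m J (principal_subtensor m A J)"
  let ?min_ev = "\<lambda>J. smallest_H_eigenvalue m J (principal_subtensor m A J)"
  define D where "D = {?min_ev J | J. J \<subseteq> ?I \<and> J \<noteq> {} \<and> (\<exists>l. ?ev J l)}"
  have delta: "delta_H m ?I A = Min D"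
    by (simp add: delta_H_def D_def)
  have "D \<subseteq> ?min_ev ` Pow ?I"
    by (auto simp: D_def)
  then have "finite D"
    by (rule finite_subset) simp
  have diag: "A (replicate m i) \<in> D" if "i \<in> ?I" for i
  proof -
    have ev: "?ev {i} l \<longleftrightarrow> l = A (replicate m i)" for l
      using assms by (intro H_eigenvalue_singleton) simp
    then have "?min_ev {i} = A (replicate m i)"
      unfolding smallest_H_eigenvalue_def by (intro Least_equality) auto
    then show ?thesis
      unfolding D_def using that ev by (intro CollectI exI[of _ "{i}"]) auto
  qed
  have "1 \<in> ?I"
    using assms by simp
  with diag have "D \<noteq> {}"
    by blast
  with \<open>finite D\<close> have "Min D \<in> D"
    by (rule Min_in)
  then obtain J l where J: "J \<subseteq> ?I" "?ev J l" "Min D = ?min_ev J"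
    by (auto simp: D_def)
  have "?ev J (Min D)"
    unfolding J(3) using assms J by (intro H_eigenvalue_smallest) (auto intro: finite_subset)
  then have "alpha ?I (F_op m ?I A) \<le> root (m - 1) (Min D)"
    using assms J(1) by (intro alpha_le_root_eigenvalue_of_subtensor) auto
  moreover have "Min D \<le> Min ((\<lambda>i. A (replicate m i)) ` ?I)"
    using \<open>finite D\<close> diag \<open>1 \<in> ?I\<close> by (intro Min_antimono) auto
  then have "root (m - 1) (Min D) \<le> root (m - 1) (Min ((\<lambda>i. A (replicate m i)) ` ?I))"
    using assms by (intro real_root_le_mono) auto
  ultimately show ?thesis
    unfolding delta by (rule conjI)
qed

end
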